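(* Let $r\ge 2$, and let $n$ and $c$ be integers, where $n$ is the number of vertices of the complete graph $K_n$ and $c$ is the number of colors. If $c>\binom{r}{2}$, then $$R_r(\mathcal{B}K_n;c)>\left(1+\frac{1}{r^2}\right)^{n-1},$$ where $R_r(\mathcal{B}K_n;c)$ is the smallest $N$ such that every coloring of the hyperedges of the complete $r$-uniform hypergraph $K_N^r$ with $c$ colors contains a monochromatic Berge copy of $K_n$.
   Context: $K_n$ is the complete graph on $n$ vertices. $K_N^r$ is the complete $r$-uniform hypergraph on $N$ vertices: its hyperedges are all $r$-element subsets of an $N$-element vertex set. A hypergraph $H$ contains a Berge copy of a graph $G$ if there are injections $\Psi_1:V(G)\to V(H)$ and $\Psi_2:E(G)\to E(H)$ such that for every edge $uv\in E(G)$ we have $\Psi_1(u),\Psi_1(v)\in\Psi_2(uv)$; that is, the edges of $G$ are mapped to distinct hyperedges, each containing the images of both endpoints of the corresponding edge. If in addition $|E(H)|=|E(G)|$, then $H$ is called a Berge-$G$; such hypergraphs are denoted by $\mathcal{B}G$. A $c$-coloring of the hyperedges of $K_N^r$ assigns to each hyperedge one of $c$ colors (arbitrarily). A coloring contains a monochromatic $\mathcal{B}G$ (a monochromatic Berge copy of $G$) if for some color the hypergraph formed by all hyperedges of that color contains a Berge copy of $G$. $R_r(\mathcal{B}G;c)$ denotes the smallest $N$ such that every $c$-coloring of the hyperedges of $K_N^r$ contains a monochromatic $\mathcal{B}G$.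
   Formalization: The number of vertices n is assumed to be at least 2; for n = 1 the graph K_1 has no edges, the Ramsey number is 1 and equals (1+1/r^2)^0, so the strict inequality fails (likewise for n = 0). *)

theory Defs
  imports Complex_Main "HOL-Library.Ramsey"
begin

text \<open>A (hyper)graph is a pair of a vertex set and a set of (hyper)edges, the edges being sets of
  vertices; graphs are the 2-uniform case.\<close>

type_synonym 'a hypergraph = "'a set \<times> 'a set set"

abbreviation verts :: "'a hypergraph \<Rightarrow> 'a set" where
  "verts \<equiv> fst"

abbreviation edges :: "'a hypergraph \<Rightarrow> 'a set set" where
  "edges \<equiv> snd"

definition complete_hypergraph :: "nat \<Rightarrow> nat \<Rightarrow> nat hypergraph" where
  "complete_hypergraph r N = ({..<N}, nsets {..<N} r)"

definition complete_graph :: "nat \<Rightarrow> nat hypergraph" where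
  "complete_graph n = complete_hypergraph 2 n"

definition contains_berge :: "'b hypergraph \<Rightarrow> 'a hypergraph \<Rightarrow> bool" where
  "contains_berge H G \<longleftrightarrow>
    (\<exists>\<Psi>1 \<Psi>2.
      \<Psi>1 \<in> verts G \<rightarrow> verts H \<and> inj_on \<Psi>1 (verts G) \<and>
      \<Psi>2 \<in> edges G \<rightarrow> edges H \<and> inj_on \<Psi>2 (edges G) \<and>
      (\<forall>u v. {u, v} \<in> edges G \<longrightarrow> \<Psi>1 u \<in> \<Psi>2 {u, v} \<and> \<Psi>1 v \<in> \<Psi>2 {u, v}))"

text \<open>A colour class keeps all vertices of the host hypergraph, including those that lie in no
  hyperedge of that colour.\<close>

definition color_class :: "'b hypergraph \<Rightarrow> ('b set \<Rightarrow> nat) \<Rightarrow> nat \<Rightarrow> 'b hypergraph" where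
  "color_class H \<chi> i = (verts H, {e \<in> edges H. \<chi> e = i})"

definition berge_ramsey :: "nat \<Rightarrow> 'a hypergraph \<Rightarrow> nat \<Rightarrow> nat" where
  "berge_ramsey r G c =
    (LEAST N. \<forall>\<chi> \<in> edges (complete_hypergraph r N) \<rightarrow> {..<c}.
       \<exists>i<c. contains_berge (color_class (complete_hypergraph r N) \<chi> i) G)"

end

theory Submission
  imports Defs
begin

text \<open>
  Put \<open>b = r choose 2\<close> and \<open>k = b + 1 \<le> c\<close>, and suppose that \<open>N \<le> (1 + 1/r\<^sup>2) ^ (n - 1)\<close>.  A
  colouring of the hyperedges without a monochromatic Berge-\<open>K\<^sub>n\<close> is read off from a \<open>k\<close>-colouring
  \<open>f\<close> of the \<^emph>\<open>pairs\<close> of vertices: an \<open>r\<close>-set spans only \<open>b < k\<close> pairs, so some colour is missing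
  among them, and the \<open>r\<close>-set is given such a missing colour.  If the hyperedges of colour \<open>i\<close>
  contained a Berge-\<open>K\<^sub>n\<close> with core \<open>S\<close>, every pair inside \<open>S\<close> would lie in a hyperedge of colour \<open>i\<close>
  and hence would not have colour \<open>i\<close> under \<open>f\<close>.  So it is enough that every \<open>n\<close>-set sees all \<open>k\<close>
  colours on its pairs (\<open>avoiding_coloring\<close>).

  For a random \<open>f\<close>, a fixed \<open>n\<close>-set misses a fixed colour with probability
  \<open>(b / k) ^ (n choose 2)\<close>.  By the union bound (\<open>ex_coloring_all_colors\<close>) a suitable \<open>f\<close> exists as
  soon as \<open>(N choose n) * k * b ^ (n choose 2) < k ^ (n choose 2)\<close>.  This holds because
  \<open>(1 + 1/r\<^sup>2)\<^sup>2 \<le> k / b\<close>, so that \<open>N ^ n \<le> (k / b) ^ (n choose 2)\<close>, while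
  \<open>(N choose n) * n! \<le> N ^ n\<close> and \<open>k < n!\<close>.  The last inequality can only fail for \<open>n \<le> r\<^sup>2\<close>, and
  then the growth rate \<open>1 + 1/r\<^sup>2\<close> is so small that \<open>N < n\<close>, whence \<open>N choose n = 0\<close>
  (\<open>union_bound_numeric\<close>).

  The lower bound says something about the least \<open>N\<close> only if some \<open>N\<close> forces a monochromatic
  Berge-\<open>K\<^sub>n\<close>; this is Ramsey's theorem for \<open>r\<close>-sets (\<open>ex_berge_ramsey\<close>).
\<close>

section \<open>Finiteness of Berge-Ramsey numbers of complete graphs\<close>

text \<open>Attaching one fixed set of \<open>r - 2\<close> further vertices to every edge of \<open>K\<^sub>n\<close> turns distinct
  edges into distinct \<open>r\<close>-sets, so \<open>n + (r - 2)\<close> vertices suffice to host a Berge copy.\<close>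

lemma contains_berge_complete:
  assumes "r \<ge> 2" and H: "H \<in> nsets (verts G) (n + (r - 2))" and E: "nsets H r \<subseteq> edges G"
  shows "contains_berge G (complete_graph n)"
proof -
  define W where "W = {n..<n + (r - 2)}"
  have "finite H" "card H = n + (r - 2)" "H \<subseteq> verts G"
    using H by (auto simp: nsets_def)
  then obtain g where g: "bij_betw g {..<n + (r - 2)} H"
    using finite_same_card_bij[of "{..<n + (r - 2)}" H] by auto
  have inj: "inj_on g {..<n + (r - 2)}" and im: "g ` {..<n + (r - 2)} = H"
    using g by (auto simp: bij_betw_def)
  have eW: "e \<union> W \<in> nsets {..<n + (r - 2)} r" "e \<inter> W = {}" if "e \<in> nsets {..<n} 2" for e
  proof -
    show disj: "e \<inter> W = {}"
      using that by (auto simp: nsets_def W_def)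
    have "finite e" "card e = 2" "e \<subseteq> {..<n}"
      using that by (auto simp: nsets_def)
    moreover have "card (e \<union> W) = card e + card W"
      using disj \<open>finite e\<close> by (simp add: card_Un_disjoint W_def)
    ultimately show "e \<union> W \<in> nsets {..<n + (r - 2)} r"
      using \<open>r \<ge> 2\<close> by (auto simp: nsets_def W_def)
  qed
  show ?thesis
    unfolding contains_berge_def
  proof (intro exI conjI)
    show "g \<in> verts (complete_graph n) \<rightarrow> verts G"
      using im \<open>H \<subseteq> verts G\<close> by (auto simp: complete_graph_def complete_hypergraph_def)
    show "inj_on g (verts (complete_graph n))"
      by (rule inj_on_subset[OF inj]) (auto simp: complete_graph_def complete_hypergraph_def)
    show "(\<lambda>e. g ` (e \<union> W)) \<in> edges (complete_graph n) \<rightarrow> edges G"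
    proof
      fix e assume "e \<in> edges (complete_graph n)"
      then have "e \<union> W \<in> nsets {..<n + (r - 2)} r"
        using eW by (simp add: complete_graph_def complete_hypergraph_def)
      then have "g ` (e \<union> W) \<in> nsets H r"
        using bij_betw_nsets[OF g, of r] by (auto simp: bij_betw_def)
      then show "g ` (e \<union> W) \<in> edges G"
        using E by blast
    qed
    show "inj_on (\<lambda>e. g ` (e \<union> W)) (edges (complete_graph n))"
    proof (rule inj_onI)
      fix e e' assume e: "e \<in> edges (complete_graph n)" "e' \<in> edges (complete_graph n)"
        and eq: "g ` (e \<union> W) = g ` (e' \<union> W)"
      have e': "e \<in> nsets {..<n} 2" "e' \<in> nsets {..<n} 2"
        using e by (auto simp: complete_graph_def complete_hypergraph_def)
      have "e \<union> W = e' \<union> W"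
        using inj_onD[OF inj_on_nsets[OF inj] eq] eW e' by blast
      then show "e = e'"
        using eW(2)[OF e'(1)] eW(2)[OF e'(2)] by blast
    qed
  qed auto
qed

lemma ex_berge_ramsey:
  assumes "r \<ge> 2"
  shows "\<exists>N. \<forall>\<chi> \<in> edges (complete_hypergraph r N) \<rightarrow> {..<c}.
           \<exists>i<c. contains_berge (color_class (complete_hypergraph r N) \<chi> i) (complete_graph n)"
proof -
  obtain N :: nat where N: "partn_lst {..<N} (replicate c (n + (r - 2))) r"
    using ramsey_full by blast
  have "\<exists>i<c. contains_berge (color_class (complete_hypergraph r N) \<chi> i) (complete_graph n)"
    if "\<chi> \<in> edges (complete_hypergraph r N) \<rightarrow> {..<c}" for \<chi>
  proof -
    have "\<chi> \<in> nsets {..<N} r \<rightarrow> {..<length (replicate c (n + (r - 2)))}"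
      using that by (simp add: complete_hypergraph_def)
    then obtain i H where i: "i < c" and H: "H \<in> nsets {..<N} (n + (r - 2))"
      and mono: "\<chi> ` nsets H r \<subseteq> {i}"
      using N unfolding partn_lst_def monochromatic_def by fastforce
    have "nsets H r \<subseteq> nsets {..<N} r"
      using H by (intro nsets_mono) (auto simp: nsets_def)
    with mono H have "contains_berge (color_class (complete_hypergraph r N) \<chi> i) (complete_graph n)"
      by (intro contains_berge_complete[OF assms, where H = H])
        (auto simp: color_class_def complete_hypergraph_def)
    with i show ?thesis
      by blast
  qed
  then show ?thesis
    by blast
qed

section \<open>Hyperedge colourings from colourings of pairs\<close>

text \<open>The union bound, written as a count: \<open>k ^ card P\<close> colourings of the set \<open>P\<close> of pairs in all,
  of which a fraction \<open>((k - 1) / k) ^ (n choose 2)\<close> misses a given colour on a given \<open>n\<close>-set.\<close>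

lemma ex_coloring_all_colors:
  fixes V :: "'a set" and k n :: nat
  assumes "finite V" and "k > 0"
    and bound: "(card V choose n) * k * (k - 1) ^ (n choose 2) < k ^ (n choose 2)"
  shows "\<exists>f \<in> nsets V 2 \<rightarrow> {..<k}. \<forall>S \<in> nsets V n. {..<k} \<subseteq> f ` nsets S 2"
proof -
  define P where "P = nsets V 2"
  define q where "q = n choose 2"
  define I where "I = nsets V n \<times> {..<k}"
  define bad where "bad = (\<lambda>(S, i). PiE P (\<lambda>e. if e \<in> nsets S 2 then {..<k} - {i} else {..<k}))"
  have finP: "finite P" and finI: "finite I"
    using \<open>finite V\<close> by (auto simp: P_def I_def finite_imp_finite_nsets)
  have card_all: "card (PiE P (\<lambda>_. {..<k})) = k ^ card P"
    using finP by (simp add: card_PiE)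
  have card_bad: "k ^ q * card (bad x) = (k - 1) ^ q * k ^ card P" if xI: "x \<in> I" for x
  proof -
    obtain S i where x: "x = (S, i)" and S: "S \<in> nsets V n" and i: "i < k"
      using xI by (auto simp: I_def)
    have sub: "nsets S 2 \<subseteq> P"
      using S unfolding P_def by (intro nsets_mono) (auto simp: nsets_def)
    have "card S = n"
      using S by (simp add: nsets_def)
    then have q: "card (nsets S 2) = q"
      by (simp add: q_def)
    have fin: "finite (nsets S 2)"
      using finite_subset[OF sub finP] .
    have cP: "card P = q + card (P - nsets S 2)"
      using card_Diff_subset[OF fin sub] card_mono[OF finP sub] q by simp
    have "card (bad x) = (\<Prod>e\<in>P. card (if e \<in> nsets S 2 then {..<k} - {i} else {..<k}))"
      using finP by (simp add: x bad_def card_PiE)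
    also have "\<dots> = (\<Prod>e\<in>P. if e \<in> nsets S 2 then k - 1 else k)"
      using i by (intro prod.cong) auto
    also have "\<dots> = (\<Prod>e\<in>nsets S 2. k - 1) * (\<Prod>e\<in>P - nsets S 2. k)"
      using prod.subset_diff[OF sub finP, of "\<lambda>e. if e \<in> nsets S 2 then k - 1 else k"]
      by (simp add: mult.commute)
    also have "\<dots> = (k - 1) ^ q * k ^ card (P - nsets S 2)"
      using q by simp
    finally show ?thesis
      by (simp add: cP power_add)
  qed
  have "k ^ q * card (\<Union>x\<in>I. bad x) \<le> k ^ q * (\<Sum>x\<in>I. card (bad x))"
    by (intro mult_left_mono card_UN_le finI) simp
  also have "\<dots> = (\<Sum>x\<in>I. (k - 1) ^ q * k ^ card P)"
    unfolding sum_distrib_left using card_bad by (intro sum.cong) auto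
  also have "\<dots> = ((card V choose n) * k * (k - 1) ^ q) * k ^ card P"
    by (simp add: I_def card_cartesian_product)
  also have "\<dots> < k ^ q * k ^ card P"
    using bound \<open>k > 0\<close> by (simp add: q_def)
  finally have "card (\<Union>x\<in>I. bad x) < card (PiE P (\<lambda>_. {..<k}))"
    using \<open>k > 0\<close> by (simp add: card_all)
  moreover have "finite (\<Union>x\<in>I. bad x)"
    using finI finP by (auto simp: bad_def intro!: finite_PiE)
  ultimately have "\<not> PiE P (\<lambda>_. {..<k}) \<subseteq> (\<Union>x\<in>I. bad x)"
    using card_mono leD by blast
  then obtain f where f: "f \<in> PiE P (\<lambda>_. {..<k})" and good: "\<And>x. x \<in> I \<Longrightarrow> f \<notin> bad x"
    by blast
  have "{..<k} \<subseteq> f ` nsets S 2" if S: "S \<in> nsets V n" for S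
  proof
    fix i assume "i \<in> {..<k}"
    then have "f \<notin> bad (S, i)"
      using good S by (simp add: I_def)
    with f show "i \<in> f ` nsets S 2"
      by (auto simp: bad_def PiE_iff split: if_splits)
  qed
  with f show ?thesis
    by (auto simp: P_def PiE_def)
qed

lemma avoiding_coloring:
  assumes "r choose 2 < k" and "n \<ge> 2"
    and all_colors: "\<And>S. S \<in> nsets {..<N} n \<Longrightarrow> {..<k} \<subseteq> f ` nsets S 2"
  obtains \<chi> where "\<chi> \<in> edges (complete_hypergraph r N) \<rightarrow> {..<k}"
    and "\<And>i. \<not> contains_berge (color_class (complete_hypergraph r N) \<chi> i) (complete_graph n)"
proof -
  have ex: "\<exists>i<k. i \<notin> f ` nsets e 2" if "e \<in> nsets {..<N} r" for e
  proof -
    have "finite e" "card e = r"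
      using that by (auto simp: nsets_def)
    then have "finite (nsets e 2)" "card (nsets e 2) = r choose 2"
      by (simp_all add: finite_imp_finite_nsets)
    then have "card (f ` nsets e 2) < card {..<k}"
      using card_image_le[of "nsets e 2" f] \<open>r choose 2 < k\<close> by simp
    then have "\<not> {..<k} \<subseteq> f ` nsets e 2"
      using \<open>finite (nsets e 2)\<close> by (meson card_mono finite_imageI leD)
    then show ?thesis
      by blast
  qed
  define \<chi> where "\<chi> e = (SOME i. i < k \<and> i \<notin> f ` nsets e 2)" for e
  have \<chi>: "\<chi> e < k" "\<chi> e \<notin> f ` nsets e 2" if "e \<in> nsets {..<N} r" for e
    using someI_ex[of "\<lambda>i. i < k \<and> i \<notin> f ` nsets e 2"] ex[OF that] by (auto simp: \<chi>_def)
  have "\<not> contains_berge (color_class (complete_hypergraph r N) \<chi> i) (complete_graph n)" for i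
  proof
    assume "contains_berge (color_class (complete_hypergraph r N) \<chi> i) (complete_graph n)"
    then obtain \<phi> \<psi> where \<phi>: "\<phi> \<in> {..<n} \<rightarrow> {..<N}" "inj_on \<phi> {..<n}"
      and \<psi>: "\<psi> \<in> nsets {..<n} 2 \<rightarrow> {e \<in> nsets {..<N} r. \<chi> e = i}"
      and inc: "\<And>u v. {u, v} \<in> nsets {..<n} 2 \<Longrightarrow> \<phi> u \<in> \<psi> {u, v} \<and> \<phi> v \<in> \<psi> {u, v}"
      unfolding contains_berge_def
      by (simp add: color_class_def complete_graph_def complete_hypergraph_def) blast
    \<comment> \<open>There is at least one core edge, so \<open>i\<close> really occurs as a colour below \<open>k\<close>.\<close>
    have "{0, 1} \<in> nsets {..<n} 2"
      using \<open>n \<ge> 2\<close> by simp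
    with \<psi> have "\<psi> {0, 1} \<in> nsets {..<N} r" "\<chi> (\<psi> {0, 1}) = i"
      by (auto dest!: Pi_mem)
    with \<chi>(1) have "i < k"
      by metis
    have "\<phi> ` {..<n} \<in> nsets {..<N} n"
      using \<phi> by (auto simp: nsets_def card_image)
    then have "i \<in> f ` nsets (\<phi> ` {..<n}) 2"
      using all_colors \<open>i < k\<close> by blast
    then obtain p where p: "p \<in> nsets (\<phi> ` {..<n}) 2" "f p = i"
      by blast
    from p(1) obtain u v where uv: "p = {\<phi> u, \<phi> v}" "u < n" "v < n" "\<phi> u \<noteq> \<phi> v"
      by (elim nsets2_E) auto
    then have "{u, v} \<in> nsets {..<n} 2"
      by auto
    with inc \<psi> have "\<psi> {u, v} \<in> nsets {..<N} r" "\<chi> (\<psi> {u, v}) = i"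
      and "p \<in> nsets (\<psi> {u, v}) 2"
      using uv by auto
    with \<chi>(2) p(2) show False
      by blast
  qed
  moreover have "\<chi> \<in> edges (complete_hypergraph r N) \<rightarrow> {..<k}"
    using \<chi>(1) by (simp add: complete_hypergraph_def)
  ultimately show ?thesis
    using that by blast
qed

section \<open>Numerical estimates\<close>

lemma power_one_plus_inverse_less:
  fixes x :: real
  assumes "x > 1" and "1 \<le> m" and "real m \<le> x"
  shows "(1 + 1 / x) ^ m < 1 + real m"
  using assms(2,3)
proof (induction m rule: dec_induct)
  case base
  then show ?case
    using \<open>x > 1\<close> by simp
next
  case (step m)
  have "(1 + 1 / x) ^ m < 1 + real m"
    using step.IH step.prems by simp
  then have "(1 + 1 / x) ^ Suc m < (1 + real m) * (1 + 1 / x)"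
    unfolding power_Suc2 using \<open>x > 1\<close> by (intro mult_strict_right_mono) (simp_all add: add_pos_pos)
  also have "\<dots> = 1 + real m + (1 + real m) / x"
    by (simp add: field_simps)
  also have "\<dots> \<le> 1 + real (Suc m)"
    using step.prems \<open>x > 1\<close> by simp
  finally show ?case .
qed

lemma real_choose_two: "2 * real (r choose 2) = real r * (real r - 1)"
  by (induction r) (simp_all add: numeral_2_eq_2 algebra_simps)

lemma square_one_plus_le:
  assumes "r \<ge> 2"
  shows "(1 + 1 / real r ^ 2) ^ 2 \<le> 1 + 1 / real (r choose 2)"
proof -
  define x where "x = real r"
  have x: "x \<ge> 2"
    using assms by (simp add: x_def)
  have b: "real (r choose 2) = x * (x - 1) / 2"
    using real_choose_two[of r] by (simp add: x_def)
  have "(2 * x ^ 2 + 1) * (x * (x - 1)) \<le> 2 * x ^ 4"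
  proof -
    have "2 * x ^ 4 - (2 * x ^ 2 + 1) * (x * (x - 1)) = x * (2 * x * (x - 1) + x + 1)"
      by (simp add: algebra_simps power4_eq_xxxx power2_eq_square)
    moreover have "\<dots> \<ge> 0"
      using x by (intro mult_nonneg_nonneg add_nonneg_nonneg) auto
    ultimately show ?thesis
      by linarith
  qed
  then have "(2 * x ^ 2 + 1) / x ^ 4 \<le> 2 / (x * (x - 1))"
    using x by (simp add: divide_simps)
  moreover have "(1 + 1 / x ^ 2) ^ 2 = 1 + (2 * x ^ 2 + 1) / x ^ 4"
    using x by (simp add: field_simps power4_eq_xxxx power2_eq_square)
  ultimately show ?thesis
    by (simp add: b flip: x_def)
qed

lemma union_bound_numeric:
  fixes r n N :: nat
  assumes r: "r \<ge> 2" and n: "n \<ge> 2" and N: "real N \<le> (1 + 1 / real r ^ 2) ^ (n - 1)"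
  shows "(N choose n) * Suc (r choose 2) * (r choose 2) ^ (n choose 2) < Suc (r choose 2) ^ (n choose 2)"
proof (cases "n \<le> N")
  case False
  then show ?thesis
    by (simp add: binomial_eq_0)
next
  case True
  define b where "b = r choose 2"
  define q where "q = n choose 2"
  have b: "b > 0"
    using r by (simp add: b_def)
  have r4: "real r ^ 2 \<ge> 4"
    using power_mono[of 2 "real r" 2] r by simp
  have large: "r ^ 2 + 1 < n"
  proof (rule ccontr)
    assume "\<not> r ^ 2 + 1 < n"
    then have "real (n - 1) \<le> real (r ^ 2)"
      by (subst of_nat_le_iff) simp
    then have "real (n - 1) \<le> real r ^ 2"
      by simp
    then have "(1 + 1 / real r ^ 2) ^ (n - 1) < 1 + real (n - 1)"
      using r4 n by (intro power_one_plus_inverse_less) auto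
    with N True n show False
      by simp
  qed
  have "2 * real b \<le> 2 * real r ^ 2"
    using r unfolding b_def real_choose_two by (simp add: power2_eq_square algebra_simps)
  then have "real (Suc b) < real n"
    using large by (simp flip: of_nat_power)
  then have fact_gt: "Suc b < fact n"
    using fact_ge_self[of n] by (simp add: less_le_trans)
  have two_q: "(n - 1) * n = 2 * q"
    using n by (simp add: q_def choose_two mult.commute)
  have "real ((N choose n) * Suc b) < real ((N choose n) * fact n)"
    using fact_gt True unfolding of_nat_less_iff by (intro mult_strict_left_mono) simp_all
  also have "\<dots> \<le> real (N ^ n)"
    unfolding of_nat_le_iff by (rule binomial_fact_pow)
  also have "\<dots> \<le> ((1 + 1 / real r ^ 2) ^ (n - 1)) ^ n"
    unfolding of_nat_power using N by (intro power_mono) auto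
  also have "\<dots> = ((1 + 1 / real r ^ 2) ^ 2) ^ q"
    by (simp only: two_q flip: power_mult)
  also have "\<dots> \<le> (1 + 1 / real b) ^ q"
    using square_one_plus_le[OF r] by (intro power_mono) (auto simp: b_def)
  also have "\<dots> = real (Suc b) ^ q / real b ^ q"
    using b by (simp add: field_simps flip: power_divide)
  finally have "real ((N choose n) * Suc b) * real b ^ q < real (Suc b) ^ q"
    using b by (simp add: pos_less_divide_eq)
  then have "real ((N choose n) * Suc b * b ^ q) < real (Suc b ^ q)"
    by simp
  then show ?thesis
    unfolding b_def q_def of_nat_less_iff .
qed

section \<open>The lower bound\<close>

theorem mainTheorem1:
  fixes r n c :: nat
  assumes "r \<ge> 2" and "n \<ge> 2" and "c > r choose 2"
  shows "real (berge_ramsey r (complete_graph n) c) > (1 + 1 / real r ^ 2) ^ (n - 1)"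
proof (rule ccontr)
  define N where "N = berge_ramsey r (complete_graph n) c"
  define k where "k = Suc (r choose 2)"
  assume "\<not> ?thesis"
  then have "(N choose n) * k * (k - 1) ^ (n choose 2) < k ^ (n choose 2)"
    using union_bound_numeric[OF assms(1,2), of N] by (simp add: N_def k_def)
  then have "\<exists>f \<in> nsets {..<N} 2 \<rightarrow> {..<k}. \<forall>S \<in> nsets {..<N} n. {..<k} \<subseteq> f ` nsets S 2"
    by (intro ex_coloring_all_colors) (simp_all add: k_def)
  then obtain f where "\<And>S. S \<in> nsets {..<N} n \<Longrightarrow> {..<k} \<subseteq> f ` nsets S 2"
    by blast
  then obtain \<chi> where \<chi>: "\<chi> \<in> edges (complete_hypergraph r N) \<rightarrow> {..<k}"
    and no: "\<And>i. \<not> contains_berge (color_class (complete_hypergraph r N) \<chi> i) (complete_graph n)"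
    using avoiding_coloring[of r k n N f] assms(2) by (auto simp: k_def)
  have "\<chi> \<in> edges (complete_hypergraph r N) \<rightarrow> {..<c}"
    using \<chi> assms(3) by (force simp: k_def)
  moreover have "\<forall>\<chi> \<in> edges (complete_hypergraph r N) \<rightarrow> {..<c}.
      \<exists>i<c. contains_berge (color_class (complete_hypergraph r N) \<chi> i) (complete_graph n)"
    unfolding N_def berge_ramsey_def by (rule LeastI_ex) (rule ex_berge_ramsey[OF assms(1)])
  ultimately show False
    using no by blast
qed

end
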